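(* Let $K$ be a field, $V$ a vector space over $K$, $A:V\to V$ a linear operator, $n\ge 2$, $b_1,\dots,b_n\in K$ and $\varphi_1,\dots,\varphi_n\in V$. If $x_1,\dots,x_n\in V$ satisfy the system $$A(x_j)=b_1x_1+b_2x_2+\dots+b_nx_n+\varphi_j,\qquad 1\le j\le n,$$ then they satisfy $$\Delta_{\check B}(A)(x_j)=A^{n-1}(\varphi_j)+\sum_{\substack{1\le i\le n\\ i\neq j}}b_i\big(A^{n-2}(\varphi_i)-A^{n-2}(\varphi_j)\big),\qquad 1\le j\le n.$$
   Context: $\check B\in K^{n\times n}$ is the matrix whose $(j,k)$ entry is $b_k$ for all $1\le j,k\le n$ (every row equals $(b_1,b_2,\dots,b_n)$). $\Delta_{\check B}(\lambda)=\det(\lambda I-\check B)$ is its characteristic polynomial, and $\Delta_{\check B}(A)$ is the linear operator on $V$ obtained by substituting $A$ for $\lambda$ (powers of $A$ are iterated compositions, $A^0$ is the identity). *)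

theory Defs
  imports Jordan_Normal_Form.Char_Poly
begin

text \<open>
  Vector spaces are those of the locale \<^locale>\<open>vector_space\<close>: an arbitrary scalar
  multiplication \<open>scale\<close> of a field on an abelian group, without any dimension restriction.
  Scalar and vector families are indexed by \<open>1, \<dots>, n\<close>, whereas matrix indices start at \<open>0\<close>;
  hence the shift in the column index below.
\<close>

definition B_check :: "nat \<Rightarrow> (nat \<Rightarrow> 'k) \<Rightarrow> 'k mat" where
  "B_check n b = mat n n (\<lambda>(j, k). b (Suc k))"

definition poly_op :: "('k::comm_ring_1 \<Rightarrow> 'v::ab_group_add \<Rightarrow> 'v) \<Rightarrow> 'k poly \<Rightarrow> ('v \<Rightarrow> 'v) \<Rightarrow> 'v \<Rightarrow> 'v" where
  "poly_op scale p A v = (\<Sum>i\<le>degree p. scale (coeff p i) ((A ^^ i) v))"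

end

theory Submission
  imports Defs
begin

text \<open>
  All rows of \<open>B\<close> agree, so \<open>B\<close> maps everything to multiples of the all-ones vector, on which it
  acts by \<open>s = b\<^sub>1 + \<dots> + b\<^sub>n\<close>. Completing the all-ones vector to a basis with the unit vectors
  \<open>e\<^sub>2, \<dots>, e\<^sub>n\<close> makes \<open>B\<close> upper triangular with diagonal \<open>s, 0, \<dots>, 0\<close>, whence
  \<open>\<Delta>(\<lambda>) = (\<lambda> - s) \<lambda>\<^sup>n\<^sup>-\<^sup>1\<close> (lemma \<open>char_poly_B_check\<close>).

  The common part \<open>S = b\<^sub>1 x\<^sub>1 + \<dots> + b\<^sub>n x\<^sub>n\<close> of the equations cancels in differences:
  \<open>A x\<^sub>i - A x\<^sub>j = \<phi>\<^sub>i - \<phi>\<^sub>j\<close>. Applying \<open>A\<close> to \<open>A x\<^sub>j = S + \<phi>\<^sub>j\<close> and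
  subtracting \<open>s A x\<^sub>j\<close> therefore eliminates every unknown from the right-hand side:
  \<open>A\<^sup>2 x\<^sub>j - s A x\<^sub>j = A \<phi>\<^sub>j + (\<Sum>i. b\<^sub>i (A x\<^sub>i - A x\<^sub>j)) = A \<phi>\<^sub>j + (\<Sum>i. b\<^sub>i (\<phi>\<^sub>i - \<phi>\<^sub>j))\<close>.
  This is the claim for \<open>n = 2\<close>, and \<open>A\<^sup>n\<^sup>-\<^sup>2\<close> applied to both sides gives the general case.
\<close>

text \<open>
  The columns of the matrix \<open>P\<close> below are the all-ones vector and the unit vectors other than the
  first one; the inverse \<open>Q\<close> subtracts the first coordinate from all others.
\<close>

lemma char_poly_B_check:
  fixes b :: "nat \<Rightarrow> 'k::field"
  assumes "n > 0"
  shows "char_poly (B_check n b) = [:- (\<Sum>i=1..n. b i), 1:] * monom 1 (n - 1)"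
proof -
  define s where "s = (\<Sum>i=1..n. b i)"
  have s_eq: "s = (\<Sum>k<n. b (Suc k))"
    unfolding s_def by (simp add: sum.atLeast1_atMost_eq)
  define P :: "'k mat" where "P = mat n n (\<lambda>(i, k). if i = k \<or> k = 0 then 1 else 0)"
  define Q :: "'k mat"
    where "Q = mat n n (\<lambda>(i, k). if i = k then 1 else if k = 0 then -1 else 0)"
  define T :: "'k mat"
    where "T = mat n n (\<lambda>(i, k). if i = 0 then (if k = 0 then s else b (Suc k)) else 0)"
  have carrier: "P \<in> carrier_mat n n" "Q \<in> carrier_mat n n" "T \<in> carrier_mat n n"
    "B_check n b \<in> carrier_mat n n"
    by (auto simp: P_def Q_def T_def B_check_def)
  (* Left multiplication by P or Q only involves row 0 and row i. *)
  have mult_P: "(P * M) $$ (i, k) = (if i = 0 then 0 else M $$ (i, k)) + M $$ (0, k)"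
    if "M \<in> carrier_mat n n" "i < n" "k < n" for M i k
  proof -
    have "(P * M) $$ (i, k) = (\<Sum>l<n. (if i = l \<or> l = 0 then 1 else 0) * M $$ (l, k))"
      using that by (auto simp: P_def scalar_prod_def lessThan_atLeast0 intro!: sum.cong)
    also have "\<dots> = (\<Sum>l<n. (if l = i then if i = 0 then 0 else M $$ (i, k) else 0)
        + (if l = 0 then M $$ (0, k) else 0))"
      by (intro sum.cong) auto
    also have "\<dots> = (if i = 0 then 0 else M $$ (i, k)) + M $$ (0, k)"
      unfolding sum.distrib using that assms by simp
    finally show ?thesis .
  qed
  have mult_Q: "(Q * M) $$ (i, k) = M $$ (i, k) - (if i = 0 then 0 else M $$ (0, k))"
    if "M \<in> carrier_mat n n" "i < n" "k < n" for M i k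
  proof -
    have "(Q * M) $$ (i, k)
        = (\<Sum>l<n. (if i = l then 1 else if l = 0 then -1 else 0) * M $$ (l, k))"
      using that by (auto simp: Q_def scalar_prod_def lessThan_atLeast0 intro!: sum.cong)
    also have "\<dots> = (\<Sum>l<n. (if l = i then M $$ (i, k) else 0)
        - (if l = 0 then if i = 0 then 0 else M $$ (0, k) else 0))"
      by (intro sum.cong) auto
    also have "\<dots> = M $$ (i, k) - (if i = 0 then 0 else M $$ (0, k))"
      unfolding sum_subtractf using that assms by simp
    finally show ?thesis .
  qed
  have "P * Q = 1\<^sub>m n"
    using carrier mult_P[of Q] by (intro eq_matI) (auto simp: Q_def)
  moreover have "Q * P = 1\<^sub>m n"
    using carrier mult_Q[of P] by (intro eq_matI) (auto simp: P_def)
  moreover have "B_check n b = P * T * Q"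
  proof (rule eq_matI)
    fix i k assume "i < dim_row (P * T * Q)" "k < dim_col (P * T * Q)"
    then have ik: "i < n" "k < n" using carrier by auto
    have "(P * T * Q) $$ (i, k) = (P * (T * Q)) $$ (i, k)"
      using carrier by simp
    also have "\<dots> = (T * Q) $$ (0, k)"
    proof -
      have "(T * Q) $$ (i, k) = 0" if "i \<noteq> 0"
        using that ik by (auto simp: T_def Q_def scalar_prod_def intro!: sum.neutral)
      then show ?thesis
        using mult_P[OF mult_carrier_mat[OF carrier(3,2)] ik] by simp
    qed
    also have "\<dots> = (\<Sum>l<n. (if l = 0 then s else b (Suc l))
        * (if l = k then 1 else if k = 0 then -1 else 0))"
      using ik assms by (auto simp: T_def Q_def scalar_prod_def lessThan_atLeast0 intro!: sum.cong)
    also have "\<dots> = b (Suc k)"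
    proof (cases "k = 0")
      case True
      have "s = b 1 + (\<Sum>l\<in>{..<n} - {0}. b (Suc l))"
        unfolding s_eq using assms by (subst sum.remove[of _ 0]) auto
      moreover have "(\<Sum>l\<in>{..<n} - {0}. (if l = 0 then s else b (Suc l))
          * (if l = 0 then 1 else -1)) = - (\<Sum>l\<in>{..<n} - {0}. b (Suc l))"
        by (simp add: sum_negf[symmetric])
      ultimately show ?thesis
        using True assms by (subst sum.remove[of _ 0]) auto
    next
      case False
      then show ?thesis using ik by (simp add: if_distrib[of "(*) _"] cong: if_cong)
    qed
    also have "\<dots> = B_check n b $$ (i, k)" using ik by (simp add: B_check_def)
    finally show "B_check n b $$ (i, k) = (P * T * Q) $$ (i, k)" by simp
  qed (use carrier in auto)
  ultimately have "similar_mat_wit (B_check n b) T P Q"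
    using carrier by (simp add: similar_mat_wit_def Let_def)
  then have "similar_mat (B_check n b) T"
    unfolding similar_mat_def by blast
  then have "char_poly (B_check n b) = char_poly T"
    by (rule char_poly_similar)
  also have "\<dots> = (\<Prod>a\<leftarrow>diag_mat T. [:- a, 1:])"
    using carrier by (intro char_poly_upper_triangular[of _ n]) (auto simp: T_def)
  also have "diag_mat T = s # replicate (n - 1) 0"
    using assms by (intro nth_equalityI) (auto simp: diag_mat_def T_def nth_Cons')
  also have "(\<Prod>a\<leftarrow>\<dots>. [:- a, 1:]) = [:- s, 1:] * monom 1 (n - 1)"
    by (simp add: monom_altdef)
  finally show ?thesis unfolding s_def .
qed

lemma poly_op_linear_times_monom:
  fixes scale :: "'k::field \<Rightarrow> 'v::ab_group_add \<Rightarrow> 'v"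
  assumes "vector_space scale"
  shows "poly_op scale ([:- s, 1:] * monom 1 m) A v = (A ^^ Suc m) v - scale s ((A ^^ m) v)"
proof -
  interpret vector_space scale by fact
  let ?p = "[:- s, 1:] * monom 1 m"
  have deg: "degree ?p = Suc m"
    by (subst degree_mult_eq) (auto simp: degree_monom_eq monom_eq_0_iff)
  have coeff: "coeff ?p i = (if i = Suc m then 1 else if i = m then - s else 0)" for i
    by (auto simp: mult.commute[of _ "monom 1 m"] coeff_monom_mult coeff_pCons split: nat.splits)
  have "(\<Sum>i<m. scale (coeff ?p i) ((A ^^ i) v)) = 0"
    by (intro sum.neutral) (simp add: coeff del: mult_pCons_left)
  then show ?thesis
    unfolding poly_op_def deg
    by (simp add: coeff lessThan_Suc_atMost[symmetric] del: mult_pCons_left)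
qed

lemma linear_funpow:
  assumes "Vector_Spaces.linear scale scale A"
  shows "Vector_Spaces.linear scale scale (A ^^ m)"
proof (induction m)
  case 0
  interpret Vector_Spaces.linear scale scale A by fact
  show ?case using vs1.linear_id by (simp add: id_def)
next
  case (Suc m)
  then show ?case
    using Vector_Spaces.linear_compose[OF Suc assms] by (simp add: comp_def)
qed

theorem theorem4p4:
  fixes scale :: "'k::field \<Rightarrow> 'v::ab_group_add \<Rightarrow> 'v"
    and A :: "'v \<Rightarrow> 'v"
    and n :: nat
    and b :: "nat \<Rightarrow> 'k"
    and \<phi> x :: "nat \<Rightarrow> 'v"
  assumes "vector_space scale"
    and "Vector_Spaces.linear scale scale A"
    and "n \<ge> 2"
    and "\<forall>j\<in>{1..n}. A (x j) = (\<Sum>i=1..n. scale (b i) (x i)) + \<phi> j"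
  shows "\<forall>j\<in>{1..n}. poly_op scale (char_poly (B_check n b)) A (x j) =
           (A ^^ (n - 1)) (\<phi> j) +
           (\<Sum>i\<in>{1..n} - {j}. scale (b i) ((A ^^ (n - 2)) (\<phi> i) - (A ^^ (n - 2)) (\<phi> j)))"
proof
  fix j assume j: "j \<in> {1..n}"
  interpret A: Vector_Spaces.linear scale scale A by fact
  define m where "m = n - 2"
  have n: "n = Suc (Suc m)" using assms(3) by (simp add: m_def)
  interpret Am: Vector_Spaces.linear scale scale "A ^^ m"
    using assms(2) by (rule linear_funpow)
  define S where "S = (\<Sum>i=1..n. scale (b i) (x i))"
  define s where "s = (\<Sum>i=1..n. b i)"
  have eqn: "A (x i) = S + \<phi> i" if "i \<in> {1..n}" for i
    using assms(4) that by (simp add: S_def)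
  have "A S - scale s (A (x j)) = (\<Sum>i=1..n. scale (b i) (A (x i) - A (x j)))"
    unfolding S_def s_def
    by (simp add: A.sum A.scale A.vs1.scale_sum_left A.vs1.scale_right_diff_distrib sum_subtractf)
  also have "\<dots> = (\<Sum>i=1..n. scale (b i) (\<phi> i - \<phi> j))"
    using eqn j by (intro sum.cong) auto
  finally have elim: "A (A (x j)) - scale s (A (x j))
      = A (\<phi> j) + (\<Sum>i=1..n. scale (b i) (\<phi> i - \<phi> j))"
    using eqn[OF j] by (simp add: A.add algebra_simps)
  have "poly_op scale (char_poly (B_check n b)) A (x j)
      = (A ^^ n) (x j) - scale s ((A ^^ (n - 1)) (x j))"
    using char_poly_B_check[of n b] poly_op_linear_times_monom[OF assms(1), of s "n - 1"]
    by (simp add: s_def n del: mult_pCons_left)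
  also have "\<dots> = (A ^^ m) (A (A (x j)) - scale s (A (x j)))"
    by (simp add: n Am.diff Am.scale funpow_swap1)
  also have "\<dots> = (A ^^ m) (A (\<phi> j))
      + (\<Sum>i=1..n. scale (b i) ((A ^^ m) (\<phi> i) - (A ^^ m) (\<phi> j)))"
    by (simp only: elim Am.add Am.sum Am.scale Am.diff)
  also have "(A ^^ m) (A (\<phi> j)) = (A ^^ (n - 1)) (\<phi> j)"
    by (simp add: n funpow_swap1)
  also have "(\<Sum>i=1..n. scale (b i) ((A ^^ m) (\<phi> i) - (A ^^ m) (\<phi> j)))
      = (\<Sum>i\<in>{1..n} - {j}. scale (b i) ((A ^^ m) (\<phi> i) - (A ^^ m) (\<phi> j)))"
    using j by (subst sum.remove[of _ j]) auto
  finally show "poly_op scale (char_poly (B_check n b)) A (x j) =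
      (A ^^ (n - 1)) (\<phi> j) +
      (\<Sum>i\<in>{1..n} - {j}. scale (b i) ((A ^^ (n - 2)) (\<phi> i) - (A ^^ (n - 2)) (\<phi> j)))"
    unfolding m_def .
qed

end
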